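(* Let $\mathcal G_{\mathcal R}(\mathfrak P,\mathcal E^-,\mathcal E^+)$ and $\mathcal G_{\widetilde{\mathcal R}}(\widetilde{\mathfrak P},\widetilde{\mathcal E}^-,\widetilde{\mathcal E}^+)$ be $\mathcal R$-graphs. If the $\mathcal R$-graph semigroups $\mathcal S_{\mathcal R}(\mathfrak P,\mathcal E^-,\mathcal E^+)$ and $\mathcal S_{\widetilde{\mathcal R}}(\widetilde{\mathfrak P},\widetilde{\mathcal E}^-,\widetilde{\mathcal E}^+)$ are isomorphic (as semigroups with zero), then the $\mathcal R$-graphs $\mathcal G_{\mathcal R}(\mathfrak P,\mathcal E^-,\mathcal E^+)$ and $\mathcal G_{\widetilde{\mathcal R}}(\widetilde{\mathfrak P},\widetilde{\mathcal E}^-,\widetilde{\mathcal E}^+)$ are isomorphic.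
   Context: **Partitioned graph.** A finite directed graph with vertex set $\mathfrak P$ and edge set $\mathcal E=\mathcal E^-\cup\mathcal E^+$ (disjoint union), $s$ and $t$ denoting source and target. Set $\mathcal E^-(\mathfrak q,\mathfrak r)=\{e^-\in\mathcal E^-: s(e^-)=\mathfrak q,\ t(e^-)=\mathfrak r\}$ and $\mathcal E^+(\mathfrak q,\mathfrak r)=\{e^+\in\mathcal E^+: s(e^+)=\mathfrak r,\ t(e^+)=\mathfrak q\}$. It is assumed that $\mathcal E^-(\mathfrak q,\mathfrak r)\ne\emptyset$ if and only if $\mathcal E^+(\mathfrak q,\mathfrak r)\neq\emptyset$, for all $\mathfrak q,\mathfrak r\in\mathfrak P$, and that the directed graph $(\mathfrak P,\mathcal E^-)$ is strongly connected. **$\mathcal R$-graph.** A partitioned graph together with relations $\mathcal R(\mathfrak q,\mathfrak r)\subset\mathcal E^-(\mathfrak q,\mathfrak r)\times\mathcal E^+(\mathfrak q,\mathfrak r)$, $\mathfrak q,\mathfrak r\in\mathfrak P$; $\mathcal R=\bigcup_{\mathfrak q,\mathfrak r}\mathcal R(\mathfrak q,\mathfrak r)$. Notation: $\mathcal G_{\mathcal R}(\mathfrak P,\mathcal E^-,\mathcal E^+)$. An isomorphism of $\mathcal R$-graphs consists of bijections between the vertex sets, between the sets $\mathcal E^-$, and between the sets $\mathcal E^+$, that respect sources and targets and carry the relation $\mathcal R$ onto the relation $\widetilde{\mathcal R}$. **$\mathcal R$-graph semigroup** $\mathcal S_{\mathcal R}(\mathfrak P,\mathcal E^-,\mathcal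 E^+)$: the semigroup with zero generated by elements $\mathbf 1_{\mathfrak p}$ ($\mathfrak p\in\mathfrak P$) and $\mathcal E^-\cup\mathcal E^+$ with defining relations $\mathbf 1_{\mathfrak p}^2=\mathbf 1_{\mathfrak p}$; $\mathbf 1_{\mathfrak q}\mathbf 1_{\mathfrak r}=0$ for $\mathfrak q\neq\mathfrak r$; $\mathbf 1_{\mathfrak q}e^-=e^-\mathbf 1_{\mathfrak r}=e^-$ for $e^-\in\mathcal E^-(\mathfrak q,\mathfrak r)$; $\mathbf 1_{\mathfrak r}e^+=e^+\mathbf 1_{\mathfrak q}=e^+$ for $e^+\in\mathcal E^+(\mathfrak q,\mathfrak r)$; and, for $f^-\in\mathcal E^-(\mathfrak q,\mathfrak r)$, $g^+\in\mathcal E^+(\mathfrak q',\mathfrak r)$: $f^-g^+=\mathbf 1_{\mathfrak q}$ if $\mathfrak q=\mathfrak q'$ and $(f^-,g^+)\in\mathcal R(\mathfrak q,\mathfrak r)$, and $f^-g^+=0$ otherwise. *)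

theory Defs
  imports "Graph_Theory.Digraph_Component"
begin

section \<open>Semigroups with zero given by generators and relations\<close>

record 'a semigroup0 =
  sg_carrier :: "'a set"
  sg_mult :: "'a \<Rightarrow> 'a \<Rightarrow> 'a"
  sg_zero :: 'a

locale semigroup_with_zero =
  fixes S :: "'a semigroup0"
  assumes zero_closed: "sg_zero S \<in> sg_carrier S"
    and mult_closed: "\<lbrakk>x \<in> sg_carrier S; y \<in> sg_carrier S\<rbrakk> \<Longrightarrow> sg_mult S x y \<in> sg_carrier S"
    and mult_assoc: "\<lbrakk>x \<in> sg_carrier S; y \<in> sg_carrier S; z \<in> sg_carrier S\<rbrakk>
      \<Longrightarrow> sg_mult S (sg_mult S x y) z = sg_mult S x (sg_mult S y z)"
    and zero_left: "x \<in> sg_carrier S \<Longrightarrow> sg_mult S (sg_zero S) x = sg_zero S"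
    and zero_right: "x \<in> sg_carrier S \<Longrightarrow> sg_mult S x (sg_zero S) = sg_zero S"

definition semigroup0_isomorphic :: "'a semigroup0 \<Rightarrow> 'b semigroup0 \<Rightarrow> bool" where
  "semigroup0_isomorphic S T \<longleftrightarrow>
     (\<exists>h. bij_betw h (sg_carrier S) (sg_carrier T)
        \<and> (\<forall>x\<in>sg_carrier S. \<forall>y\<in>sg_carrier S. h (sg_mult S x y) = sg_mult T (h x) (h y))
        \<and> h (sg_zero S) = sg_zero T)"

text \<open>The free semigroup with zero on \<open>X\<close>: its nonzero elements are the nonempty words
  over \<open>X\<close> (as \<open>Some w\<close>), and \<open>None\<close> is the zero. The empty word is excluded because the
  structures considered are semigroups and not monoids.\<close>

definition free_carrier :: "'g set \<Rightarrow> 'g list option set" where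
  "free_carrier X = insert None (Some ` (lists X - {[]}))"

fun free_mult :: "'g list option \<Rightarrow> 'g list option \<Rightarrow> 'g list option" where
  "free_mult (Some v) (Some w) = Some (v @ w)"
| "free_mult _ _ = None"

inductive_set generated_congruence ::
    "'g set \<Rightarrow> ('g list option \<times> 'g list option) set \<Rightarrow> ('g list option \<times> 'g list option) set"
  for X R where
  base: "\<lbrakk>(a, b) \<in> R; a \<in> free_carrier X; b \<in> free_carrier X\<rbrakk> \<Longrightarrow> (a, b) \<in> generated_congruence X R"
| refl: "a \<in> free_carrier X \<Longrightarrow> (a, a) \<in> generated_congruence X R"
| sym: "(a, b) \<in> generated_congruence X R \<Longrightarrow> (b, a) \<in> generated_congruence X R"
| trans: "\<lbrakk>(a, b) \<in> generated_congruence X R; (b, c) \<in> generated_congruence X R\<rbrakk>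
    \<Longrightarrow> (a, c) \<in> generated_congruence X R"
| left: "\<lbrakk>(a, b) \<in> generated_congruence X R; c \<in> free_carrier X\<rbrakk>
    \<Longrightarrow> (free_mult c a, free_mult c b) \<in> generated_congruence X R"
| right: "\<lbrakk>(a, b) \<in> generated_congruence X R; c \<in> free_carrier X\<rbrakk>
    \<Longrightarrow> (free_mult a c, free_mult b c) \<in> generated_congruence X R"

definition presented_semigroup0 ::
    "'g set \<Rightarrow> ('g list option \<times> 'g list option) set \<Rightarrow> 'g list option set semigroup0" where
  "presented_semigroup0 X R =
     \<lparr> sg_carrier = free_carrier X // generated_congruence X R,
       sg_mult = (\<lambda>A B. generated_congruence X R `` {c. \<exists>a\<in>A. \<exists>b\<in>B. c = free_mult a b}),
       sg_zero = generated_congruence X R `` {None} \<rparr>"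

lemma free_mult_assoc: "free_mult (free_mult a b) c = free_mult a (free_mult b c)"
  by (cases a; cases b; cases c) auto

lemma free_mult_None [simp]: "free_mult None a = None" "free_mult a None = None"
  by (cases a; simp)+

lemma free_mult_closed:
  "\<lbrakk>a \<in> free_carrier X; b \<in> free_carrier X\<rbrakk> \<Longrightarrow> free_mult a b \<in> free_carrier X"
  unfolding free_carrier_def by (auto simp: image_iff)

lemma generated_congruence_carrier:
  "(a, b) \<in> generated_congruence X R \<Longrightarrow> a \<in> free_carrier X \<and> b \<in> free_carrier X"
  by (induction rule: generated_congruence.induct) (auto intro: free_mult_closed)

lemma equiv_generated_congruence: "equiv (free_carrier X) (generated_congruence X R)"
  unfolding equiv_def
  by (auto simp: refl_on_def sym_def trans_def
      dest: generated_congruence_carrier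
      intro: generated_congruence.refl generated_congruence.sym generated_congruence.trans)

lemma generated_congruence_mult:
  assumes "(a, a') \<in> generated_congruence X R" "(b, b') \<in> generated_congruence X R"
  shows "(free_mult a b, free_mult a' b') \<in> generated_congruence X R"
  using assms generated_congruence_carrier generated_congruence.left
    generated_congruence.right generated_congruence.trans by metis

lemma presented_mult_class:
  assumes "a \<in> free_carrier X" "b \<in> free_carrier X"
  shows "sg_mult (presented_semigroup0 X R)
           (generated_congruence X R `` {a}) (generated_congruence X R `` {b})
         = generated_congruence X R `` {free_mult a b}"
  using assms
  by (auto simp: presented_semigroup0_def
      intro: generated_congruence.refl generated_congruence.sym
        generated_congruence.trans generated_congruence_mult)

lemma presented_semigroup0_is_semigroup_with_zero:
  "semigroup_with_zero (presented_semigroup0 X R)"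
proof -
  have N: "None \<in> free_carrier X" by (simp add: free_carrier_def)
  have C: "sg_carrier (presented_semigroup0 X R) = free_carrier X // generated_congruence X R"
    and Z: "sg_zero (presented_semigroup0 X R) = generated_congruence X R `` {None}"
    by (simp_all add: presented_semigroup0_def)
  show ?thesis
    by unfold_locales
      (auto simp: C Z N presented_mult_class free_mult_assoc free_mult_closed
        elim!: quotientE intro!: quotientI)
qed


section \<open>Partitioned graphs and R-graphs\<close>

text \<open>\<open>rel G q r\<close> is the relation \<open>\<R>(q, r)\<close>; only its values at vertices \<open>q\<close>, \<open>r\<close> matter.\<close>

record ('v, 'e) r_graph =
  vertices :: "'v set"
  neg_edges :: "'e set"
  pos_edges :: "'e set"
  source :: "'e \<Rightarrow> 'v"
  target :: "'e \<Rightarrow> 'v"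
  rel :: "'v \<Rightarrow> 'v \<Rightarrow> ('e \<times> 'e) set"

definition underlying_digraph :: "('v, 'e) r_graph \<Rightarrow> ('v, 'e) pre_digraph" where
  "underlying_digraph G = \<lparr> verts = vertices G, arcs = neg_edges G \<union> pos_edges G,
     tail = source G, head = target G \<rparr>"

definition neg_digraph :: "('v, 'e) r_graph \<Rightarrow> ('v, 'e) pre_digraph" where
  "neg_digraph G = \<lparr> verts = vertices G, arcs = neg_edges G,
     tail = source G, head = target G \<rparr>"

definition neg_between :: "('v, 'e) r_graph \<Rightarrow> 'v \<Rightarrow> 'v \<Rightarrow> 'e set" where
  "neg_between G q r = {e \<in> neg_edges G. source G e = q \<and> target G e = r}"

text \<open>Positive edges run in the opposite direction: \<open>pos_between G q r\<close> goes from \<open>r\<close> to \<open>q\<close>.\<close>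

definition pos_between :: "('v, 'e) r_graph \<Rightarrow> 'v \<Rightarrow> 'v \<Rightarrow> 'e set" where
  "pos_between G q r = {e \<in> pos_edges G. source G e = r \<and> target G e = q}"

locale partitioned_graph =
  fixes G :: "('v, 'e) r_graph"
  assumes fin_digraph_underlying: "fin_digraph (underlying_digraph G)"
    and disjoint_edges: "neg_edges G \<inter> pos_edges G = {}"
    and neg_iff_pos: "\<lbrakk>q \<in> vertices G; r \<in> vertices G\<rbrakk>
      \<Longrightarrow> neg_between G q r \<noteq> {} \<longleftrightarrow> pos_between G q r \<noteq> {}"
    and strongly_connected_neg: "strongly_connected (neg_digraph G)"

locale is_r_graph = partitioned_graph +
  assumes rel_subset: "\<lbrakk>q \<in> vertices G; r \<in> vertices G\<rbrakk>
      \<Longrightarrow> rel G q r \<subseteq> neg_between G q r \<times> pos_between G q r"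

definition total_rel :: "('v, 'e) r_graph \<Rightarrow> ('e \<times> 'e) set" where
  "total_rel G = (\<Union>q\<in>vertices G. \<Union>r\<in>vertices G. rel G q r)"

definition r_graph_isomorphic :: "('v, 'e) r_graph \<Rightarrow> ('w, 'f) r_graph \<Rightarrow> bool" where
  "r_graph_isomorphic G H \<longleftrightarrow>
     (\<exists>\<phi> \<psi>\<^sub>m \<psi>\<^sub>p.
        bij_betw \<phi> (vertices G) (vertices H)
      \<and> bij_betw \<psi>\<^sub>m (neg_edges G) (neg_edges H)
      \<and> bij_betw \<psi>\<^sub>p (pos_edges G) (pos_edges H)
      \<and> (\<forall>e\<in>neg_edges G. source H (\<psi>\<^sub>m e) = \<phi> (source G e) \<and> target H (\<psi>\<^sub>m e) = \<phi> (target G e))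
      \<and> (\<forall>e\<in>pos_edges G. source H (\<psi>\<^sub>p e) = \<phi> (source G e) \<and> target H (\<psi>\<^sub>p e) = \<phi> (target G e))
      \<and> map_prod \<psi>\<^sub>m \<psi>\<^sub>p ` total_rel G = total_rel H)"


section \<open>The R-graph semigroup\<close>

datatype ('v, 'e) generator = Idem 'v | Edge 'e

definition r_graph_generators :: "('v, 'e) r_graph \<Rightarrow> ('v, 'e) generator set" where
  "r_graph_generators G = Idem ` vertices G \<union> Edge ` (neg_edges G \<union> pos_edges G)"

inductive_set r_graph_relations ::
    "('v, 'e) r_graph \<Rightarrow> (('v, 'e) generator list option \<times> ('v, 'e) generator list option) set"
  for G where
  idem: "p \<in> vertices G \<Longrightarrow>
    (Some [Idem p, Idem p], Some [Idem p]) \<in> r_graph_relations G"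
| orthogonal: "\<lbrakk>q \<in> vertices G; r \<in> vertices G; q \<noteq> r\<rbrakk> \<Longrightarrow>
    (Some [Idem q, Idem r], None) \<in> r_graph_relations G"
| neg_left: "\<lbrakk>q \<in> vertices G; r \<in> vertices G; e \<in> neg_between G q r\<rbrakk> \<Longrightarrow>
    (Some [Idem q, Edge e], Some [Edge e]) \<in> r_graph_relations G"
| neg_right: "\<lbrakk>q \<in> vertices G; r \<in> vertices G; e \<in> neg_between G q r\<rbrakk> \<Longrightarrow>
    (Some [Edge e, Idem r], Some [Edge e]) \<in> r_graph_relations G"
| pos_left: "\<lbrakk>q \<in> vertices G; r \<in> vertices G; e \<in> pos_between G q r\<rbrakk> \<Longrightarrow>
    (Some [Idem r, Edge e], Some [Edge e]) \<in> r_graph_relations G"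
| pos_right: "\<lbrakk>q \<in> vertices G; r \<in> vertices G; e \<in> pos_between G q r\<rbrakk> \<Longrightarrow>
    (Some [Edge e, Idem q], Some [Edge e]) \<in> r_graph_relations G"
| cancel: "\<lbrakk>q \<in> vertices G; r \<in> vertices G; f \<in> neg_between G q r; g \<in> pos_between G q r;
      (f, g) \<in> rel G q r\<rbrakk> \<Longrightarrow>
    (Some [Edge f, Edge g], Some [Idem q]) \<in> r_graph_relations G"
| annihilate: "\<lbrakk>q \<in> vertices G; q' \<in> vertices G; r \<in> vertices G;
      f \<in> neg_between G q r; g \<in> pos_between G q' r;
      \<not> (q = q' \<and> (f, g) \<in> rel G q r)\<rbrakk> \<Longrightarrow>
    (Some [Edge f, Edge g], None) \<in> r_graph_relations G"

definition r_graph_semigroup ::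
    "('v, 'e) r_graph \<Rightarrow> ('v, 'e) generator list option set semigroup0" where
  "r_graph_semigroup G = presented_semigroup0 (r_graph_generators G) (r_graph_relations G)"

end

theory Submission
  imports Defs
begin

text \<open>
  Since \<open>f\<^sup>- g\<^sup>+\<close> always reduces to an idempotent or to zero, a nonzero element of the semigroup
  has a unique normal form \<open>u v\<close>: a path \<open>u\<close> of positive edges followed by a path \<open>v\<close> of negative
  edges, where \<open>u\<close> and \<open>v\<close> may be empty and both are empty for an idempotent \<open>1\<^sub>p\<close>. Existence is a
  reduction of words. Uniqueness follows from letting words act on normal forms by left
  multiplication: the action respects the defining relations (\<open>relation_free_act\<close>), and a normal
  form is recovered from its action on the idempotent of its end vertex (\<open>nf_word_inj\<close>). So the
  semigroup is isomorphic to one whose elements are zero and the normal forms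
  (\<open>nf_semigroup_isomorphic\<close>).

  There the R-graph is visible to the multiplication alone.

  \<^item> The \<open>1\<^sub>p\<close> are the nonzero \<open>e\<close> with \<open>e x \<in> {x, 0}\<close> for all \<open>x\<close> (\<open>local_units_nf\<close>).

  \<^item> The paths \<open>v\<close> of negative edges from \<open>p\<close> are the nonzero \<open>x = 1\<^sub>p x\<close> for which \<open>y \<mapsto> y x\<close> is
    injective on the left ideal of \<open>1\<^sub>p\<close> (\<open>right_cancellable_nf\<close>). Indeed \<open>(u' v') v\<close> is already
    in normal form. If, on the other hand, \<open>x\<close> begins with a positive edge \<open>g\<close>, then either some
    \<open>f\<close> is related to \<open>g\<close>, and \<open>g f g = g\<close> shows that \<open>g f\<close> and \<open>1\<^sub>p\<close> have the same product with
    \<open>x\<close>; or there is none, and any negative edge \<open>f\<close> parallel to the reverse of \<open>g\<close> is a nonzero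
    element with \<open>f x = 0\<close>. Dually for paths of positive edges.

  \<^item> The edges are the paths of one sign that are not products of two nontrivial paths of the same
    sign (\<open>irreducibles_paths_in\<close>).

  \<^item> Incidence and relation are read off from products: \<open>1\<^sub>p e = e\<close> says that \<open>e\<close> starts at \<open>p\<close>,
    \<open>e 1\<^sub>r = e\<close> that it ends at \<open>r\<close>, and \<open>f g\<close> is one of the \<open>1\<^sub>q\<close> exactly if \<open>f\<close> and \<open>g\<close> are
    related.

  An isomorphism of the semigroups preserves all this data and so restricts to bijections of the
  vertices, the negative and the positive edges that form an isomorphism of R-graphs.
\<close>

section \<open>Isomorphisms of semigroups with zero\<close>

definition semigroup0_iso ::
    "'a semigroup0 \<Rightarrow> 'b semigroup0 \<Rightarrow> ('a \<Rightarrow> 'b) \<Rightarrow> bool" where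
  "semigroup0_iso S T h \<longleftrightarrow> bij_betw h (sg_carrier S) (sg_carrier T)
     \<and> (\<forall>x\<in>sg_carrier S. \<forall>y\<in>sg_carrier S. h (sg_mult S x y) = sg_mult T (h x) (h y))
     \<and> h (sg_zero S) = sg_zero T"

lemma semigroup0_isomorphic_iff_iso:
  "semigroup0_isomorphic S T \<longleftrightarrow> (\<exists>h. semigroup0_iso S T h)"
  by (simp add: semigroup0_isomorphic_def semigroup0_iso_def)

lemma semigroup0_isomorphic_trans:
  assumes "semigroup0_isomorphic S T" "semigroup0_isomorphic T U"
  shows "semigroup0_isomorphic S U"
proof -
  obtain h k where h: "semigroup0_iso S T h" and k: "semigroup0_iso T U k"
    using assms by (auto simp: semigroup0_isomorphic_iff_iso)
  have "h x \<in> sg_carrier T" if "x \<in> sg_carrier S" for x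
    using h that by (auto simp: semigroup0_iso_def bij_betw_def)
  then have "semigroup0_iso S U (k \<circ> h)"
    using h k by (auto simp: semigroup0_iso_def intro: bij_betw_trans)
  then show ?thesis by (auto simp: semigroup0_isomorphic_iff_iso)
qed

lemma semigroup0_isomorphic_sym:
  assumes "semigroup0_isomorphic S T" "semigroup_with_zero S"
  shows "semigroup0_isomorphic T S"
proof -
  interpret semigroup_with_zero S by fact
  obtain h where h: "semigroup0_iso S T h"
    using assms by (auto simp: semigroup0_isomorphic_iff_iso)
  let ?k = "inv_into (sg_carrier S) h"
  have inj: "inj_on h (sg_carrier S)" and im: "sg_carrier T = h ` sg_carrier S"
    and bij: "bij_betw h (sg_carrier S) (sg_carrier T)"
    and hom: "\<And>x y. x \<in> sg_carrier S \<Longrightarrow> y \<in> sg_carrier S \<Longrightarrow>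
      sg_mult T (h x) (h y) = h (sg_mult S x y)"
    and z: "sg_zero T = h (sg_zero S)"
    using h by (auto simp: semigroup0_iso_def bij_betw_def)
  have "semigroup0_iso T S ?k"
    unfolding semigroup0_iso_def
    using bij_betw_inv_into[OF bij] inj
    by (simp add: im hom z zero_closed mult_closed)
  then show ?thesis by (auto simp: semigroup0_isomorphic_iff_iso)
qed

section \<open>Intrinsically defined subsets of a semigroup with zero\<close>

text \<open>Each set below is defined from the multiplication and the zero only (and from \<open>A\<close>, in the case of
  the irreducible elements of \<open>A\<close>), so that an isomorphism carries it onto the set of the same name
  in the other semigroup. In the semigroup of an R-graph
  they single out the vertex idempotents, the paths of negative edges, the paths of positive edges,
  and the edges among these paths.\<close>

definition local_units :: "'a semigroup0 \<Rightarrow> 'a set" where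
  "local_units S = {e \<in> sg_carrier S. e \<noteq> sg_zero S \<and>
     (\<forall>x\<in>sg_carrier S. sg_mult S e x = x \<or> sg_mult S e x = sg_zero S)}"

text \<open>Cancellation can be asked only for factors that are composable with \<open>x\<close>, which is what the local
  unit \<open>e\<close> expresses: all products \<open>y x\<close> with \<open>y e = 0\<close> vanish. As \<open>z = 0\<close> is admitted, the
  condition includes that \<open>y x\<close> is nonzero for all nonzero \<open>y = y e\<close>.\<close>

definition right_cancellable :: "'a semigroup0 \<Rightarrow> 'a set" where
  "right_cancellable S = {x \<in> sg_carrier S. x \<noteq> sg_zero S \<and>
     (\<exists>e\<in>local_units S. sg_mult S e x = x \<and>
       (\<forall>y\<in>sg_carrier S. \<forall>z\<in>sg_carrier S. sg_mult S y e = y \<longrightarrow> sg_mult S z e = z \<longrightarrow>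
         sg_mult S y x = sg_mult S z x \<longrightarrow> y = z))}"

definition left_cancellable :: "'a semigroup0 \<Rightarrow> 'a set" where
  "left_cancellable S = {x \<in> sg_carrier S. x \<noteq> sg_zero S \<and>
     (\<exists>e\<in>local_units S. sg_mult S x e = x \<and>
       (\<forall>y\<in>sg_carrier S. \<forall>z\<in>sg_carrier S. sg_mult S e y = y \<longrightarrow> sg_mult S e z = z \<longrightarrow>
         sg_mult S x y = sg_mult S x z \<longrightarrow> y = z))}"

definition irreducibles :: "'a semigroup0 \<Rightarrow> 'a set \<Rightarrow> 'a set" where
  "irreducibles S A = {x \<in> A - local_units S.
     \<forall>y\<in>A. \<forall>z\<in>A. x = sg_mult S y z \<longrightarrow> y \<in> local_units S \<or> z \<in> local_units S}"

lemma local_units_carrier: "local_units U \<subseteq> sg_carrier U"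
  by (auto simp: local_units_def)

lemma cancellable_carrier:
  "right_cancellable U \<subseteq> sg_carrier U" "left_cancellable U \<subseteq> sg_carrier U"
  by (auto simp: right_cancellable_def left_cancellable_def)

context
  fixes S :: "'a semigroup0" and T :: "'b semigroup0" and h :: "'a \<Rightarrow> 'b"
  assumes S: "semigroup_with_zero S" and h: "semigroup0_iso S T h"
begin

lemma iso_inj: "inj_on h (sg_carrier S)"
  and iso_carrier: "sg_carrier T = h ` sg_carrier S"
  and iso_mult: "\<And>x y. x \<in> sg_carrier S \<Longrightarrow> y \<in> sg_carrier S \<Longrightarrow>
      sg_mult T (h x) (h y) = h (sg_mult S x y)"
  and iso_zero: "sg_zero T = h (sg_zero S)"
  using h by (auto simp: semigroup0_iso_def bij_betw_def)

lemmas iso_simps = iso_carrier iso_mult iso_zero inj_on_eq_iff[OF iso_inj]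
  semigroup_with_zero.zero_closed[OF S] semigroup_with_zero.mult_closed[OF S]

lemma iso_local_units_iff:
  assumes "x \<in> sg_carrier S"
  shows "h x \<in> local_units T \<longleftrightarrow> x \<in> local_units S"
  using assms by (simp add: local_units_def iso_simps)

lemma iso_image_eq:
  assumes "A \<subseteq> sg_carrier S" "B \<subseteq> sg_carrier T"
    and "\<And>x. x \<in> sg_carrier S \<Longrightarrow> h x \<in> B \<longleftrightarrow> x \<in> A"
  shows "B = h ` A"
  using assms by (auto simp: iso_carrier)

lemma iso_local_units: "local_units T = h ` local_units S"
  by (rule iso_image_eq) (auto simp: iso_local_units_iff local_units_carrier
    dest: local_units_carrier[THEN subsetD])

lemma iso_right_cancellable: "right_cancellable T = h ` right_cancellable S"
proof (rule iso_image_eq)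
  have [simp]: "e \<in> local_units S \<Longrightarrow> e \<in> sg_carrier S" for e
    by (simp add: local_units_def)
  fix x assume "x \<in> sg_carrier S"
  then show "h x \<in> right_cancellable T \<longleftrightarrow> x \<in> right_cancellable S"
    by (simp add: right_cancellable_def iso_local_units iso_simps cong: bex_cong)
qed (auto simp: right_cancellable_def)

lemma iso_left_cancellable: "left_cancellable T = h ` left_cancellable S"
proof (rule iso_image_eq)
  have [simp]: "e \<in> local_units S \<Longrightarrow> e \<in> sg_carrier S" for e
    by (simp add: local_units_def)
  fix x assume "x \<in> sg_carrier S"
  then show "h x \<in> left_cancellable T \<longleftrightarrow> x \<in> left_cancellable S"
    by (simp add: left_cancellable_def iso_local_units iso_simps cong: bex_cong)
qed (auto simp: left_cancellable_def)

lemma iso_irreducibles: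
  assumes A: "A \<subseteq> sg_carrier S"
  shows "irreducibles T (h ` A) = h ` irreducibles S A"
proof (rule iso_image_eq)
  have [simp]: "x \<in> A \<Longrightarrow> x \<in> sg_carrier S" for x
    using A by auto
  fix x assume x: "x \<in> sg_carrier S"
  have "h x \<in> h ` A \<longleftrightarrow> x \<in> A"
    using x A by (metis inj_on_image_mem_iff iso_inj)
  with x show "h x \<in> irreducibles T (h ` A) \<longleftrightarrow> x \<in> irreducibles S A"
    by (simp add: irreducibles_def iso_local_units_iff iso_simps cong: ball_cong)
qed (use A in \<open>auto simp: irreducibles_def iso_carrier\<close>)

end

section \<open>Normal forms in an R-graph semigroup\<close>

type_synonym ('v, 'e) normal_form = "('v \<times> 'e list) option"

text \<open>Left multiplication by a generator. A pair \<open>(p, es)\<close> stands for the product of \<open>Idem p\<close> and the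
  edges \<open>es\<close>, so that \<open>(p, [])\<close> is the idempotent itself. The action is defined on all pairs and not
  only on paths: the defining relations already hold as identities between maps on all pairs,
  and no invariant has to be carried through the induction over the congruence.\<close>

fun gen_act :: "('v, 'e) r_graph \<Rightarrow> ('v, 'e) generator \<Rightarrow> ('v, 'e) normal_form \<Rightarrow> ('v, 'e) normal_form"
where
  "gen_act G a None = None"
| "gen_act G (Idem q) (Some (p, es)) = (if q = p then Some (p, es) else None)"
| "gen_act G (Edge e) (Some (p, es)) =
     (if target G e \<noteq> p then None
      else if e \<in> neg_edges G \<and> es \<noteq> [] \<and> hd es \<in> pos_edges G
      then if (e, hd es) \<in> total_rel G then Some (source G e, tl es) else None
      else Some (source G e, e # es))"

abbreviation word_act ::
    "('v, 'e) r_graph \<Rightarrow> ('v, 'e) generator list \<Rightarrow> ('v, 'e) normal_form \<Rightarrow> ('v, 'e) normal_form"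
where "word_act G \<equiv> foldr (gen_act G)"

fun free_act ::
    "('v, 'e) r_graph \<Rightarrow> ('v, 'e) generator list option \<Rightarrow> ('v, 'e) normal_form \<Rightarrow> ('v, 'e) normal_form"
where
  "free_act G None s = None"
| "free_act G (Some w) s = word_act G w s"

fun nf_word :: "('v, 'e) normal_form \<Rightarrow> ('v, 'e) generator list option" where
  "nf_word None = None"
| "nf_word (Some (p, es)) = Some (Idem p # map Edge es)"

fun is_path :: "('v, 'e) r_graph \<Rightarrow> 'v \<Rightarrow> 'e list \<Rightarrow> bool" where
  "is_path G p [] \<longleftrightarrow> p \<in> vertices G"
| "is_path G p (e # es) \<longleftrightarrow>
     e \<in> neg_edges G \<union> pos_edges G \<and> source G e = p \<and> is_path G (target G e) es"

fun path_end :: "('v, 'e) r_graph \<Rightarrow> 'v \<Rightarrow> 'e list \<Rightarrow> 'v" where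
  "path_end G p [] = p"
| "path_end G p (e # es) = path_end G (target G e) es"

text \<open>On a path this excludes exactly the factors \<open>f\<^sup>- g\<^sup>+\<close>, the only ones that can be reduced.\<close>

fun pos_before_neg :: "('v, 'e) r_graph \<Rightarrow> 'e list \<Rightarrow> bool" where
  "pos_before_neg G [] \<longleftrightarrow> True"
| "pos_before_neg G (e # es) \<longleftrightarrow> (e \<in> neg_edges G \<longrightarrow> set es \<subseteq> neg_edges G) \<and> pos_before_neg G es"

definition normal_forms :: "('v, 'e) r_graph \<Rightarrow> ('v, 'e) normal_form set" where
  "normal_forms G = insert None (Some ` {(p, es). is_path G p es \<and> pos_before_neg G es})"

text \<open>The product lets a word for the left factor act on the right factor. It is associative
  because congruent words act alike.\<close>

definition nf_semigroup :: "('v, 'e) r_graph \<Rightarrow> ('v, 'e) normal_form semigroup0" where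
  "nf_semigroup G = \<lparr> sg_carrier = normal_forms G,
     sg_mult = (\<lambda>x y. free_act G (nf_word x) y), sg_zero = None \<rparr>"

abbreviation vertex_unit :: "'v \<Rightarrow> ('v, 'e) normal_form" where
  "vertex_unit p \<equiv> Some (p, [])"

abbreviation edge_nf :: "('v, 'e) r_graph \<Rightarrow> 'e \<Rightarrow> ('v, 'e) normal_form" where
  "edge_nf G e \<equiv> Some (source G e, [e])"

lemma nf_semigroup_simps [simp]:
  "sg_carrier (nf_semigroup G) = normal_forms G"
  "sg_mult (nf_semigroup G) x y = free_act G (nf_word x) y"
  "sg_zero (nf_semigroup G) = None"
  by (simp_all add: nf_semigroup_def)

lemma None_normal_form [simp]: "None \<in> normal_forms G"
  by (simp add: normal_forms_def)

lemma Some_normal_form [simp]: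
  "Some (p, es) \<in> normal_forms G \<longleftrightarrow> is_path G p es \<and> pos_before_neg G es"
  by (auto simp: normal_forms_def)

lemma word_act_None [simp]: "word_act G w None = None"
  by (induction w) auto

lemma free_act_None [simp]: "free_act G a None = None"
  by (cases a) auto

lemma free_act_mult: "free_act G (free_mult a b) s = free_act G a (free_act G b s)"
  by (cases a; cases b) auto

lemma path_end_append [simp]: "path_end G p (es @ fs) = path_end G (path_end G p es) fs"
  by (induction es arbitrary: p) auto

context is_r_graph
begin

lemma edge_ends:
  assumes "e \<in> neg_edges G \<or> e \<in> pos_edges G"
  shows source_vertex: "source G e \<in> vertices G" and target_vertex: "target G e \<in> vertices G"
proof -
  interpret D: fin_digraph "underlying_digraph G" by (rule fin_digraph_underlying)
  show "source G e \<in> vertices G" "target G e \<in> vertices G"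
    using D.tail_in_verts[of e] D.head_in_verts[of e] assms
    by (auto simp: underlying_digraph_def)
qed

lemma not_neg_pos: "e \<in> neg_edges G \<Longrightarrow> e \<in> pos_edges G \<Longrightarrow> False"
  using disjoint_edges by auto

lemma rel_iff_total_rel:
  assumes "f \<in> neg_between G q r" "q \<in> vertices G" "r \<in> vertices G"
  shows "(f, g) \<in> rel G q r \<longleftrightarrow> (f, g) \<in> total_rel G"
  using assms rel_subset by (fastforce simp: total_rel_def neg_between_def)

lemma total_relD:
  assumes "(f, g) \<in> total_rel G"
  shows "f \<in> neg_edges G" "g \<in> pos_edges G" "source G g = target G f" "target G g = source G f"
  using assms rel_subset by (fastforce simp: total_rel_def neg_between_def pos_between_def)+

lemma is_path_vertex: "is_path G p es \<Longrightarrow> p \<in> vertices G"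
  by (cases es) (auto simp: source_vertex)

lemma path_end_vertex: "is_path G p es \<Longrightarrow> path_end G p es \<in> vertices G"
  by (induction es arbitrary: p) auto

lemma is_path_append:
  "is_path G p (es @ fs) \<longleftrightarrow> is_path G p es \<and> is_path G (path_end G p es) fs"
  by (induction es arbitrary: p) (auto simp: is_path_vertex)

lemma pos_before_neg_append:
  "pos_before_neg G (es @ fs) \<longleftrightarrow> pos_before_neg G es \<and> pos_before_neg G fs \<and>
     (set es \<inter> neg_edges G \<noteq> {} \<longrightarrow> set fs \<subseteq> neg_edges G)"
  by (induction es) auto

lemma gen_act_pos:
  assumes "e \<in> pos_edges G"
  shows "gen_act G (Edge e) (Some (p, es)) =
    (if target G e = p then Some (source G e, e # es) else None)"
  using assms not_neg_pos by auto

abbreviation "congruence \<equiv> generated_congruence (r_graph_generators G) (r_graph_relations G)"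

text \<open>The relations that compare a generator with its product by an idempotent only concern the vertex
  component of a pair. In the relations for \<open>f g\<close>, the positive edge \<open>g\<close> is prepended without any
  cancellation (or the result is zero already), and so \<open>f\<close> always meets \<open>g\<close>.\<close>

lemma relation_free_act:
  assumes "(a, b) \<in> r_graph_relations G"
  shows "free_act G a s = free_act G b s"
proof (cases s)
  case (Some x)
  obtain p es where x: "x = (p, es)" by (cases x)
  show ?thesis
    using assms unfolding Some x
  proof cases
    case (cancel q r f g)
    then show "free_act G a (Some (p, es)) = free_act G b (Some (p, es))"
      using not_neg_pos[of g]
      by (auto simp: rel_iff_total_rel neg_between_def pos_between_def)
  next
    case (annihilate q q' r f g)
    then have "(f, g) \<in> total_rel G \<Longrightarrow> q \<noteq> q'"
      by (auto simp: rel_iff_total_rel)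
    moreover have "(f, g) \<in> total_rel G \<Longrightarrow> q = q'"
      using annihilate total_relD[of f g] by (auto simp: neg_between_def pos_between_def)
    ultimately have "(f, g) \<notin> total_rel G" by blast
    then show "free_act G a (Some (p, es)) = free_act G b (Some (p, es))"
      using annihilate not_neg_pos[of g] by (auto simp: neg_between_def pos_between_def)
  qed (auto simp: neg_between_def pos_between_def)
qed simp

lemma congruence_free_act:
  assumes "(a, b) \<in> congruence"
  shows "free_act G a s = free_act G b s"
  using assms
  by (induction arbitrary: s rule: generated_congruence.induct)
    (auto simp: free_act_mult relation_free_act)

section \<open>Every element has a unique normal form\<close>

text \<open>The congruence is closed under multiplication by elements of the free semigroup, which contains
  no empty word; contexts with \<open>x\<close> or \<open>y\<close> empty therefore are separate cases.\<close>

lemma congruence_relation: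
  assumes "(Some u, b) \<in> r_graph_relations G"
    and "x \<in> lists (r_graph_generators G)" "u @ y \<in> lists (r_graph_generators G)" "u \<noteq> []"
    and "b = None \<or> (\<exists>v. b = Some v \<and> v \<in> lists (r_graph_generators G) \<and> v \<noteq> [])"
  shows "(Some (x @ u @ y), case b of None \<Rightarrow> None | Some v \<Rightarrow> Some (x @ v @ y)) \<in> congruence"
proof -
  let ?F = "free_carrier (r_graph_generators G)"
  have *: "(Some u, b) \<in> congruence"
    using assms by (intro generated_congruence.base) (auto simp: free_carrier_def)
  have y: "(Some (u @ y), case b of None \<Rightarrow> None | Some v \<Rightarrow> Some (v @ y)) \<in> congruence"
  proof (cases "y = []")
    case True
    then show ?thesis using * by (cases b) auto
  next
    case False
    then have "Some y \<in> ?F" using assms by (auto simp: free_carrier_def)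
    from generated_congruence.right[OF * this] show ?thesis by (cases b) auto
  qed
  show ?thesis
  proof (cases "x = []")
    case True
    then show ?thesis using y by (cases b) auto
  next
    case False
    then have "Some x \<in> ?F" using assms by (auto simp: free_carrier_def)
    from generated_congruence.left[OF y this] show ?thesis by (cases b) auto
  qed
qed

lemma generator_Idem [simp]: "Idem p \<in> r_graph_generators G \<longleftrightarrow> p \<in> vertices G"
  and generator_Edge [simp]:
    "Edge e \<in> r_graph_generators G \<longleftrightarrow> e \<in> neg_edges G \<or> e \<in> pos_edges G"
  by (auto simp: r_graph_generators_def)

lemma edge_relations:
  assumes "e \<in> neg_edges G \<or> e \<in> pos_edges G"
  shows "(Some [Idem (source G e), Edge e], Some [Edge e]) \<in> r_graph_relations G"
    and "(Some [Edge e, Idem (target G e)], Some [Edge e]) \<in> r_graph_relations G"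
  using assms edge_ends[of e]
  by (auto intro: r_graph_relations.intros simp: neg_between_def pos_between_def)

lemma path_edges: "is_path G p es \<Longrightarrow> set es \<subseteq> neg_edges G \<union> pos_edges G"
  by (induction es arbitrary: p) auto

lemma path_edges_generators:
  "is_path G p es \<Longrightarrow> map Edge es \<in> lists (r_graph_generators G)"
  by (induction es arbitrary: p) auto

lemma gen_act_normal_form:
  assumes "s \<in> normal_forms G" "a \<in> r_graph_generators G"
  shows "gen_act G a s \<in> normal_forms G"
proof (cases s)
  case (Some x)
  obtain p es where x: "x = (p, es)" by (cases x)
  show ?thesis
  proof (cases a)
    case (Idem q)
    then show ?thesis using assms Some x by simp
  next
    case (Edge e)
    show ?thesis
    proof (cases es)
      case Nil
      then show ?thesis using assms Some x Edge by auto
    next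
      case (Cons g fs)
      then show ?thesis
        using assms Some x Edge total_relD[of e g]
        by auto
    qed
  qed
qed simp

lemma word_act_normal_form:
  assumes "s \<in> normal_forms G" "w \<in> lists (r_graph_generators G)"
  shows "word_act G w s \<in> normal_forms G"
  using assms(2) by (induction w) (auto intro: gen_act_normal_form assms(1))

lemma nf_word_free_carrier:
  assumes "s \<in> normal_forms G"
  shows "nf_word s \<in> free_carrier (r_graph_generators G)"
  using assms path_edges_generators
  by (cases s rule: nf_word.cases) (auto simp: free_carrier_def is_path_vertex)

text \<open>The action computes products modulo the relations. Its clauses come from rewriting the word
  \<open>a, Idem p, es\<close>: the idempotent is absorbed into or annihilated by \<open>a\<close>. An edge \<open>a\<close> that remains
  is either negative and followed by a positive edge, so that one of the relations for such products
  applies, or it begins the new normal form, and only the idempotent of its source is put in front.\<close>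

lemma gen_act_congruence:
  assumes s: "s \<in> normal_forms G" and a: "a \<in> r_graph_generators G"
  shows "(free_mult (Some [a]) (nf_word s), nf_word (gen_act G a s)) \<in> congruence"
proof (cases s)
  case None
  then show ?thesis by (simp add: generated_congruence.refl free_carrier_def)
next
  case (Some x)
  obtain p es where x: "x = (p, es)" by (cases x)
  have es: "is_path G p es" "pos_before_neg G es" and p: "p \<in> vertices G"
    using s Some x by (auto simp: is_path_vertex)
  have gens: "map Edge es \<in> lists (r_graph_generators G)"
    using es path_edges_generators by blast
  note trans = generated_congruence.trans
  show ?thesis
  proof (cases a)
    case (Idem q)
    have q: "q \<in> vertices G" using a Idem by simp
    show ?thesis
    proof (cases "q = p")
      case True
      then show ?thesis
        using congruence_relation[OF r_graph_relations.idem[OF p], of "[]" "map Edge es"] gens p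
          Some x Idem by simp
    next
      case False
      then show ?thesis
        using congruence_relation[OF r_graph_relations.orthogonal[OF q p False],
            of "[]" "map Edge es"] gens p q Some x Idem by simp
    qed
  next
    case (Edge e)
    have e: "e \<in> neg_edges G \<or> e \<in> pos_edges G" using a Edge by simp
    note ends = edge_ends[OF e]
    show ?thesis
    proof (cases "target G e = p")
      case False
      have "(Some (Edge e # Idem (target G e) # Idem p # map Edge es),
          Some (Edge e # Idem p # map Edge es)) \<in> congruence"
        using congruence_relation[OF edge_relations(2)[OF e], of "[]" "Idem p # map Edge es"]
          gens p e ends by simp
      moreover have "(Some (Edge e # Idem (target G e) # Idem p # map Edge es), None) \<in> congruence"
        using congruence_relation[OF r_graph_relations.orthogonal[OF ends(2) p False],
            of "[Edge e]" "map Edge es"] gens p e ends by simp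
      ultimately have "(Some (Edge e # Idem p # map Edge es), None) \<in> congruence"
        using generated_congruence.sym trans by metis
      then show ?thesis using False Some x Edge by simp
    next
      case True
      have drop: "(Some (Edge e # Idem p # map Edge es), Some (Edge e # map Edge es)) \<in> congruence"
        using congruence_relation[OF edge_relations(2)[OF e], of "[]" "map Edge es"]
          gens p e ends True by simp
      show ?thesis
      proof (cases "e \<in> neg_edges G \<and> es \<noteq> [] \<and> hd es \<in> pos_edges G")
        case False
        have "(Some (Idem (source G e) # Edge e # map Edge es), Some (Edge e # map Edge es))
            \<in> congruence"
          using congruence_relation[OF edge_relations(1)[OF e], of "[]" "map Edge es"]
            gens e ends by simp
        with drop have "(Some (Edge e # Idem p # map Edge es),
            Some (Idem (source G e) # Edge e # map Edge es)) \<in> congruence"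
          using generated_congruence.sym trans by metis
        then show ?thesis using True False Some x Edge by auto
      next
        case neg_pos: True
        then obtain g fs where g: "es = g # fs" "e \<in> neg_edges G" "g \<in> pos_edges G"
          by (cases es) auto
        have gends: "source G g = p" "target G g \<in> vertices G"
          using es g edge_ends[of g] by auto
        have eb: "e \<in> neg_between G (source G e) p" and gb: "g \<in> pos_between G (target G g) p"
          using g True gends by (auto simp: neg_between_def pos_between_def)
        have iff: "(e, g) \<in> rel G (source G e) p \<longleftrightarrow> (e, g) \<in> total_rel G"
          using rel_iff_total_rel[OF eb] ends p by simp
        have "(Some (Edge e # Edge g # map Edge fs), nf_word (gen_act G a s)) \<in> congruence"
        proof (cases "(e, g) \<in> total_rel G")
          case R: True
          then have "target G g = source G e" by (rule total_relD)
          then have "(Some [Edge e, Edge g], Some [Idem (source G e)]) \<in> r_graph_relations G"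
            using r_graph_relations.cancel[OF ends(1) p eb] gb R iff by simp
          from congruence_relation[OF this, of "[]" "map Edge fs"] show ?thesis
            using gens g ends R True Some x Edge by simp
        next
          case R: False
          then have "(Some [Edge e, Edge g], None) \<in> r_graph_relations G"
            using r_graph_relations.annihilate[OF ends(1) gends(2) p eb gb] iff by simp
          from congruence_relation[OF this, of "[]" "map Edge fs"] show ?thesis
            using gens g ends R True Some x Edge by simp
        qed
        then have "(Some (Edge e # Idem p # map Edge es), nf_word (gen_act G a s)) \<in> congruence"
          using g(1) by (intro trans[OF drop]) simp
        moreover have "free_mult (Some [a]) (nf_word s) = Some (Edge e # Idem p # map Edge es)"
          using Some x Edge by simp
        ultimately show ?thesis by simp
      qed
    qed
  qed
qed

lemma word_act_congruence:
  assumes "s \<in> normal_forms G" "w \<in> lists (r_graph_generators G)" "w \<noteq> []"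
  shows "(free_mult (Some w) (nf_word s), nf_word (word_act G w s)) \<in> congruence"
  using assms(2,3)
proof (induction w)
  case (Cons a w)
  have a: "Some [a] \<in> free_carrier (r_graph_generators G)"
    using Cons.hyps by (auto simp: free_carrier_def)
  have step: "(free_mult (Some [a]) (nf_word (word_act G w s)), nf_word (gen_act G a (word_act G w s)))
      \<in> congruence"
    using Cons.hyps word_act_normal_form[OF assms(1)] gen_act_congruence by blast
  show ?case
  proof (cases "w = []")
    case False
    have "free_mult (Some (a # w)) (nf_word s) = free_mult (Some [a]) (free_mult (Some w) (nf_word s))"
      by (cases "nf_word s") auto
    then show ?thesis
      using generated_congruence.trans[OF generated_congruence.left[OF Cons.IH[OF False] a] step]
      by simp
  qed (use step in simp)
qed simp

lemma free_act_congruence: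
  assumes "s \<in> normal_forms G" "a \<in> free_carrier (r_graph_generators G)"
  shows "(free_mult a (nf_word s), nf_word (free_act G a s)) \<in> congruence"
  using assms word_act_congruence[OF assms(1)]
  by (cases a) (auto simp: free_carrier_def intro!: generated_congruence.refl simp flip: lists_eq_set)

lemma free_act_normal_form:
  assumes "s \<in> normal_forms G" "a \<in> free_carrier (r_graph_generators G)"
  shows "free_act G a s \<in> normal_forms G"
  using assms word_act_normal_form[OF assms(1)]
  by (cases a) (auto simp: free_carrier_def simp flip: lists_eq_set)

text \<open>The last letter \<open>b\<close> of a word is fixed by right multiplication with the idempotent of the vertex at
  which it ends. The word thus equals its product with that idempotent, which the action brings into
  normal form.\<close>

lemma nf_word_exists:
  assumes "a \<in> free_carrier (r_graph_generators G)"
  shows "\<exists>s\<in>normal_forms G. (a, nf_word s) \<in> congruence"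
proof (cases a)
  case None
  then show ?thesis
    by (intro bexI[of _ None]) (auto simp: free_carrier_def intro!: generated_congruence.refl)
next
  case (Some w)
  then have "w \<noteq> []" and w: "w \<in> lists (r_graph_generators G)"
    using assms by (auto simp: free_carrier_def)
  then obtain v b where v: "w = v @ [b]" by (cases w rule: rev_cases) auto
  have b: "b \<in> r_graph_generators G" using w v by auto
  obtain r where r: "r \<in> vertices G" "(Some [b, Idem r], Some [b]) \<in> r_graph_relations G"
  proof (cases b)
    case (Idem q)
    then show ?thesis using that[of q] b r_graph_relations.idem[of q G] by simp
  next
    case (Edge e)
    then show ?thesis using that[of "target G e"] b edge_relations(2) target_vertex by auto
  qed
  have "(Some (w @ [Idem r]), Some w) \<in> congruence"
    using congruence_relation[OF r(2), of v "[]"] w v r b by simp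
  moreover have "(Some (w @ [Idem r]), nf_word (word_act G w (vertex_unit r))) \<in> congruence"
    using word_act_congruence[of "vertex_unit r" w] w \<open>w \<noteq> []\<close> r by simp
  ultimately have "(a, nf_word (word_act G w (vertex_unit r))) \<in> congruence"
    using Some generated_congruence.sym generated_congruence.trans by metis
  moreover have "word_act G w (vertex_unit r) \<in> normal_forms G"
    using word_act_normal_form w r by simp
  ultimately show ?thesis by blast
qed

lemma word_act_edges_all_neg:
  assumes "is_path G p (es @ vs)" "pos_before_neg G es" "set vs \<subseteq> neg_edges G"
  shows "word_act G (map Edge es) (Some (path_end G p es, vs)) = Some (p, es @ vs)"
  using assms
proof (induction es arbitrary: p)
  case (Cons e es)
  have "hd (es @ vs) \<notin> pos_edges G" if "e \<in> neg_edges G" "es @ vs \<noteq> []"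
    using Cons.prems that not_neg_pos hd_in_set[of "es @ vs"] by fastforce
  with Cons show ?case by (auto simp: is_path_append)
qed simp

text \<open>A path of negative edges causes no cancellation when it is multiplied from the left.\<close>

lemma nf_word_act_all_neg:
  assumes "Some (p, es) \<in> normal_forms G" "is_path G q vs" "set vs \<subseteq> neg_edges G"
  shows "free_act G (nf_word (Some (p, es))) (Some (q, vs)) =
    (if path_end G p es = q then Some (p, es @ vs) else None)"
proof (cases "path_end G p es = q")
  case True
  then show ?thesis
    using word_act_edges_all_neg[of p es vs] assms by (auto simp: is_path_append)
next
  case False
  show ?thesis
  proof (cases es rule: rev_cases)
    case Nil
    then show ?thesis using False by simp
  next
    case (snoc fs f)
    then show ?thesis using False by simp
  qed
qed

lemma nf_word_act_unit:
  assumes "s \<in> normal_forms G" "r \<in> vertices G"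
  shows "free_act G (nf_word s) (vertex_unit r) =
    (case s of Some (p, es) \<Rightarrow> if path_end G p es = r then s else None | None \<Rightarrow> None)"
  using assms nf_word_act_all_neg[of _ _ r "[]"]
  by (auto split: option.split simp del: free_act.simps(2) nf_word.simps(2))

text \<open>Normal forms \<open>s\<close> and \<open>t\<close> are told apart by their action on the idempotent at the end of \<open>s\<close>: it is
  mapped to \<open>s\<close> by the word of \<open>s\<close>, and to \<open>t\<close> or zero by the word of \<open>t\<close>.\<close>

lemma nf_word_inj:
  assumes "(nf_word s, nf_word t) \<in> congruence" "s \<in> normal_forms G" "t \<in> normal_forms G"
  shows "s = t"
proof -
  have act: "free_act G (nf_word s) u = free_act G (nf_word t) u" for u
    using congruence_free_act[OF assms(1)] .
  have *: "s = t" if s: "Some (p, es) = s" "s \<in> normal_forms G" and t: "t \<in> normal_forms G"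
    and eq: "\<And>u. free_act G (nf_word s) u = free_act G (nf_word t) u" for s t p es
  proof -
    have r: "path_end G p es \<in> vertices G" using s path_end_vertex by auto
    have "s = free_act G (nf_word s) (vertex_unit (path_end G p es))"
      using nf_word_act_unit[OF s(2) r] by (simp flip: s(1))
    also have "\<dots> = free_act G (nf_word t) (vertex_unit (path_end G p es))" by (rule eq)
    also have "\<dots> = t \<or> \<dots> = None"
      using nf_word_act_unit[OF t r] by (auto split: option.splits)
    finally show "s = t" using s(1) by auto
  qed
  show ?thesis
  proof (cases s)
    case None
    then show ?thesis
      using *[of "fst y" "snd y" t s for y] assms(2,3) act[symmetric] by (cases t) simp_all
  next
    case (Some x)
    then show ?thesis using *[of "fst x" "snd x" s t] assms act by simp
  qed
qed

lemma nf_semigroup_isomorphic: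
  "semigroup0_isomorphic (nf_semigroup G) (r_graph_semigroup G)"
proof -
  let ?k = "\<lambda>s. congruence `` {nf_word s}"
  note eq = eq_equiv_class_iff[OF equiv_generated_congruence]
  have "semigroup0_iso (nf_semigroup G) (r_graph_semigroup G) ?k"
    unfolding semigroup0_iso_def
  proof (intro conjI ballI)
    have "inj_on ?k (normal_forms G)"
    proof (rule inj_onI)
      fix x y assume xy: "x \<in> normal_forms G" "y \<in> normal_forms G" "?k x = ?k y"
      then have "(nf_word x, nf_word y) \<in> congruence"
        by (metis eq nf_word_free_carrier)
      then show "x = y" using xy nf_word_inj by simp
    qed
    moreover have "?k ` normal_forms G = free_carrier (r_graph_generators G) // congruence"
    proof (intro equalityI subsetI)
      fix A assume "A \<in> free_carrier (r_graph_generators G) // congruence"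
      then obtain a where a: "a \<in> free_carrier (r_graph_generators G)" "A = congruence `` {a}"
        by (rule quotientE)
      then obtain s where "s \<in> normal_forms G" "(a, nf_word s) \<in> congruence"
        using nf_word_exists by blast
      then show "A \<in> ?k ` normal_forms G"
        using a(2) by (simp add: equiv_class_eq[OF equiv_generated_congruence])
    next
      fix A assume "A \<in> ?k ` normal_forms G"
      then show "A \<in> free_carrier (r_graph_generators G) // congruence"
        using nf_word_free_carrier by (elim imageE) (simp add: quotientI)
    qed
    ultimately show "bij_betw ?k (sg_carrier (nf_semigroup G)) (sg_carrier (r_graph_semigroup G))"
      by (simp add: bij_betw_def r_graph_semigroup_def presented_semigroup0_def)
  next
    fix x y assume "x \<in> sg_carrier (nf_semigroup G)" "y \<in> sg_carrier (nf_semigroup G)"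
    then have xy: "x \<in> normal_forms G" "y \<in> normal_forms G" by simp_all
    note words = this[THEN nf_word_free_carrier]
    have "(free_mult (nf_word x) (nf_word y), nf_word (free_act G (nf_word x) y)) \<in> congruence"
      using free_act_congruence xy words by blast
    from equiv_class_eq[OF equiv_generated_congruence this]
    show "?k (sg_mult (nf_semigroup G) x y) = sg_mult (r_graph_semigroup G) (?k x) (?k y)"
      using words by (simp add: r_graph_semigroup_def presented_mult_class)
  qed (simp add: r_graph_semigroup_def presented_semigroup0_def)
  then show ?thesis by (auto simp: semigroup0_isomorphic_iff_iso)
qed


lemma nf_semigroup_with_zero: "semigroup_with_zero (nf_semigroup G)"
proof
  fix x y z
  assume "x \<in> sg_carrier (nf_semigroup G)" "y \<in> sg_carrier (nf_semigroup G)"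
  then have xy: "x \<in> normal_forms G" "y \<in> normal_forms G" by simp_all
  note x = nf_word_free_carrier[OF xy(1)]
  show "sg_mult (nf_semigroup G) x y \<in> sg_carrier (nf_semigroup G)"
    using free_act_normal_form[OF xy(2) x] by simp
  show "sg_mult (nf_semigroup G) (sg_mult (nf_semigroup G) x y) z =
      sg_mult (nf_semigroup G) x (sg_mult (nf_semigroup G) y z)"
    using congruence_free_act[OF free_act_congruence[OF xy(2) x], of z]
    by (simp add: free_act_mult)
qed simp_all

section \<open>Vertices and edges inside the semigroup of normal forms\<close>

text \<open>If \<open>e\<close> multiplies every \<open>x\<close> to \<open>x\<close> or zero, take for \<open>x\<close> the idempotent at the end of \<open>e\<close>: the
  product is \<open>e\<close>, hence nonzero, and so \<open>e\<close> is this idempotent.\<close>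

lemma local_units_nf: "local_units (nf_semigroup G) = vertex_unit ` vertices G"
proof (intro equalityI subsetI)
  fix e assume e: "e \<in> local_units (nf_semigroup G)"
  then obtain p es where s: "e = Some (p, es)" and nf: "e \<in> normal_forms G"
    by (auto simp: local_units_def)
  let ?r = "path_end G p es"
  have r: "?r \<in> vertices G" using nf s path_end_vertex by auto
  have "free_act G (nf_word e) (vertex_unit ?r) = e"
    using nf_word_act_unit[OF nf r] s by simp
  moreover have "free_act G (nf_word e) (vertex_unit ?r) = vertex_unit ?r
      \<or> free_act G (nf_word e) (vertex_unit ?r) = None"
    using e r by (simp add: local_units_def)
  ultimately show "e \<in> vertex_unit ` vertices G" using r s by auto
next
  fix e :: "('a, 'b) normal_form" assume "e \<in> vertex_unit ` vertices G"
  then show "e \<in> local_units (nf_semigroup G)"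
    by (auto simp: local_units_def normal_forms_def split: if_splits)
qed

definition paths_in :: "'b set \<Rightarrow> ('a, 'b) normal_form set" where
  "paths_in X = {Some (p, es) |p es. is_path G p es \<and> set es \<subseteq> X}"

lemma pos_before_neg_all_neg: "set es \<subseteq> neg_edges G \<Longrightarrow> pos_before_neg G es"
  by (induction es) auto

lemma pos_before_neg_all_pos: "set es \<subseteq> pos_edges G \<Longrightarrow> pos_before_neg G es"
  using not_neg_pos by (induction es) auto

lemma word_act_edges_all_pos:
  assumes "is_path G p us" "set us \<subseteq> pos_edges G"
  shows "word_act G (map Edge us) (Some (path_end G p us, es)) = Some (p, us @ es)"
  using assms
proof (induction us arbitrary: p)
  case (Cons u us)
  then show ?case by (simp add: gen_act_pos del: gen_act.simps(3))
qed simp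

lemma nf_word_act_all_pos:
  assumes "is_path G p us" "set us \<subseteq> pos_edges G"
  shows "free_act G (nf_word (Some (p, us))) (Some (q, es)) =
    (if path_end G p us = q then Some (p, us @ es) else None)"
proof (cases "path_end G p us = q")
  case True
  then show ?thesis
    using word_act_edges_all_pos[OF assms, of es] by auto
next
  case False
  then show ?thesis by (cases us rule: rev_cases) auto
qed

lemma unit_act: "free_act G (nf_word (vertex_unit p)) s = s \<longleftrightarrow> s = None \<or> (\<exists>es. s = Some (p, es))"
  by (cases s) (auto split: if_splits)

lemma act_unit:
  assumes "s \<in> normal_forms G" "r \<in> vertices G"
  shows "free_act G (nf_word s) (vertex_unit r) = s \<longleftrightarrow>
    s = None \<or> (\<exists>p es. s = Some (p, es) \<and> path_end G p es = r)"
  using nf_word_act_unit[OF assms]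
  by (cases s) (auto split: if_splits simp del: free_act.simps(2) nf_word.simps(2))

text \<open>The inclusion from left to right is where the assumption enters that between two vertices there
  are negative edges if and only if there are positive edges: it provides the edge \<open>f\<close> that
  witnesses the failure of cancellation when no edge is related to \<open>g\<close>.\<close>

lemma right_cancellable_nf: "right_cancellable (nf_semigroup G) = paths_in (neg_edges G)"
proof (intro equalityI subsetI)
  fix x assume "x \<in> right_cancellable (nf_semigroup G)"
  then obtain p es q where x: "x = Some (p, es)" "x \<in> normal_forms G"
    and q: "q \<in> vertices G" "free_act G (nf_word (vertex_unit q)) x = x"
    and cancel: "\<And>y z. y \<in> normal_forms G \<Longrightarrow> z \<in> normal_forms G \<Longrightarrow>
      free_act G (nf_word y) (vertex_unit q) = y \<Longrightarrow>
      free_act G (nf_word z) (vertex_unit q) = z \<Longrightarrow>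
      free_act G (nf_word y) x = free_act G (nf_word z) x \<Longrightarrow> y = z"
    by (auto simp: right_cancellable_def local_units_nf simp del: free_act.simps nf_word.simps)
  have [simp]: "q = p" using q(2) x(1) unit_act by fastforce
  have "set es \<subseteq> neg_edges G"
  proof (rule ccontr)
    assume "\<not> set es \<subseteq> neg_edges G"
    then obtain g fs where es: "es = g # fs" "g \<in> pos_edges G" "source G g = p"
      using x by (cases es) auto
    have g: "g \<notin> neg_edges G" using es not_neg_pos by blast
    have tg: "target G g \<in> vertices G" using target_vertex es by blast
    have "g \<in> pos_between G (target G g) p" using es by (simp add: pos_between_def)
    then have "neg_between G (target G g) p \<noteq> {}"
      using neg_iff_pos[OF tg q(1)] by auto
    then obtain f where f: "f \<in> neg_edges G" "source G f = target G g" "target G f = p"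
      by (auto simp: neg_between_def)
    show False
    proof (cases "\<exists>f. (f, g) \<in> total_rel G")
      case True
      then obtain f where R: "(f, g) \<in> total_rel G" by blast
      note f = total_relD[OF R]
      show False
        (* g f x = x = 1 x, because f g is the idempotent at the target of g *)
        using cancel[of "Some (p, [g, f])" "vertex_unit p"] x q(1) es f R g tg not_neg_pos
        by auto
    next
      case False
      show False
        (* f x = 0, because f and g are not related *)
        using cancel[of "Some (source G f, [f])" None] x q(1) es f False by auto
    qed
  qed
  then show "x \<in> paths_in (neg_edges G)" using x by (auto simp: paths_in_def)
next
  fix x assume "x \<in> paths_in (neg_edges G)"
  then obtain p vs where x: "x = Some (p, vs)" "is_path G p vs" "set vs \<subseteq> neg_edges G"
    by (auto simp: paths_in_def)
  have p: "p \<in> vertices G" using x is_path_vertex by blast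
  have "y = z"
    if "y \<in> normal_forms G" "z \<in> normal_forms G"
      "free_act G (nf_word y) (vertex_unit p) = y" "free_act G (nf_word z) (vertex_unit p) = z"
      "free_act G (nf_word y) x = free_act G (nf_word z) x" for y z
  proof -
    have "free_act G (nf_word y) x = (case y of None \<Rightarrow> None | Some (q, es) \<Rightarrow> Some (q, es @ vs))"
      if "y \<in> normal_forms G" "free_act G (nf_word y) (vertex_unit p) = y" for y
      using that act_unit[of y p] p nf_word_act_all_neg[OF _ x(2,3)] x(1)
      by (cases y) (auto simp del: free_act.simps(2) nf_word.simps(2))
    from this[of y] this[of z] show ?thesis
      using that by (auto split: option.splits)
  qed
  then show "x \<in> right_cancellable (nf_semigroup G)"
    using x p by (auto simp: right_cancellable_def local_units_nf pos_before_neg_all_neg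
        simp del: free_act.simps(2) nf_word.simps(2) simp add: unit_act)
qed

text \<open>The mirror image of the previous argument, applied to the last edge of \<open>x\<close>: as positive edges come
  first, \<open>x\<close> is a path of positive edges unless its last edge \<open>f\<close> is negative.\<close>

lemma left_cancellable_nf: "left_cancellable (nf_semigroup G) = paths_in (pos_edges G)"
proof (intro equalityI subsetI)
  fix x assume "x \<in> left_cancellable (nf_semigroup G)"
  then obtain p es q where x: "x = Some (p, es)" "x \<in> normal_forms G"
    and q: "q \<in> vertices G" "free_act G (nf_word x) (vertex_unit q) = x"
    and cancel: "\<And>y z. y \<in> normal_forms G \<Longrightarrow> z \<in> normal_forms G \<Longrightarrow>
      free_act G (nf_word (vertex_unit q)) y = y \<Longrightarrow>
      free_act G (nf_word (vertex_unit q)) z = z \<Longrightarrow>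
      free_act G (nf_word x) y = free_act G (nf_word x) z \<Longrightarrow> y = z"
    by (auto simp: left_cancellable_def local_units_nf simp del: free_act.simps nf_word.simps)
  have q_end: "q = path_end G p es" using act_unit[OF x(2) q(1)] q(2) x(1) by simp
  have "set es \<subseteq> pos_edges G"
  proof (rule ccontr)
    assume not_pos: "\<not> set es \<subseteq> pos_edges G"
    obtain ds f where es: "es = ds @ [f]" using not_pos by (cases es rule: rev_cases) auto
    have f: "f \<in> neg_edges G" "target G f = q"
      using x not_pos q_end
      by (auto simp: es pos_before_neg_append is_path_append dest: path_edges)
    have sf: "source G f \<in> vertices G" using source_vertex f by blast
    have "f \<in> neg_between G (source G f) q" using f by (simp add: neg_between_def)
    then have "pos_between G (source G f) q \<noteq> {}"
      using neg_iff_pos[OF sf q(1)] by auto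
    then obtain g where g: "g \<in> pos_edges G" "target G g = source G f" "source G g = q"
      by (auto simp: pos_between_def)
    show False
    proof (cases "\<exists>g. (f, g) \<in> total_rel G")
      case True
      then obtain g where R: "(f, g) \<in> total_rel G" by blast
      note g = total_relD[OF R]
      have "g \<notin> neg_edges G" using g not_neg_pos by blast
      then show False
        (* x g f = x = x 1, because f g is the idempotent at the source of f *)
        using cancel[of "Some (q, [g, f])" "vertex_unit q"] x q(1) es f R g by auto
    next
      case False
      have "g \<notin> neg_edges G" using g not_neg_pos by blast
      then show False
        (* x g = 0, because f and g are not related *)
        using cancel[of "Some (q, [g])" None] x q(1) es f g sf False by auto
    qed
  qed
  then show "x \<in> paths_in (pos_edges G)" using x by (auto simp: paths_in_def)
next
  fix x assume "x \<in> paths_in (pos_edges G)"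
  then obtain p us where x: "x = Some (p, us)" "is_path G p us" "set us \<subseteq> pos_edges G"
    by (auto simp: paths_in_def)
  let ?r = "path_end G p us"
  have r: "?r \<in> vertices G" using x path_end_vertex by blast
  have nf: "x \<in> normal_forms G" using x pos_before_neg_all_pos by simp
  have "y = z"
    if "free_act G (nf_word (vertex_unit ?r)) y = y" "free_act G (nf_word (vertex_unit ?r)) z = z"
      "free_act G (nf_word x) y = free_act G (nf_word x) z" for y z
    using that nf_word_act_all_pos[OF x(2,3)] x(1)
    by (auto simp: unit_act simp del: free_act.simps(2) nf_word.simps(2))
  moreover have "free_act G (nf_word x) (vertex_unit ?r) = x"
    using act_unit[OF nf r] x(1) by blast
  ultimately show "x \<in> left_cancellable (nf_semigroup G)"
    using x(1) nf r by (auto simp: left_cancellable_def local_units_nf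
        simp del: free_act.simps(2) nf_word.simps(2))
qed

text \<open>Where multiplication is concatenation, lengths of paths add up, and the irreducible paths are those
  of length one. \<open>X\<close> will be the set of negative or of positive edges.\<close>

lemma irreducibles_paths_in:
  assumes X: "X \<subseteq> neg_edges G \<union> pos_edges G"
    and mult: "\<And>p es q fs. is_path G p es \<Longrightarrow> is_path G q fs \<Longrightarrow> set es \<subseteq> X \<Longrightarrow> set fs \<subseteq> X \<Longrightarrow>
      free_act G (nf_word (Some (p, es))) (Some (q, fs)) =
        (if path_end G p es = q then Some (p, es @ fs) else None)"
  shows "irreducibles (nf_semigroup G) (paths_in X) = edge_nf G ` X"
proof (intro equalityI subsetI)
  fix x assume x: "x \<in> irreducibles (nf_semigroup G) (paths_in X)"
  then obtain p es where s: "x = Some (p, es)" "is_path G p es" "set es \<subseteq> X"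
    by (auto simp: irreducibles_def paths_in_def)
  have "es \<noteq> []" using x s by (auto simp: irreducibles_def local_units_nf)
  then obtain e fs where es: "es = e # fs" by (cases es) auto
  let ?y = "edge_nf G e" and ?z = "Some (target G e, fs)"
  have e: "is_path G (source G e) [e]" "set [e] \<subseteq> X" "is_path G (target G e) fs" "set fs \<subseteq> X"
    using s es target_vertex by auto
  then have "?y \<in> paths_in X" "?z \<in> paths_in X" by (auto simp: paths_in_def)
  moreover have "x = free_act G (nf_word ?y) ?z"
    using mult[OF e(1,3,2,4)] s es by simp
  ultimately have "?y \<in> vertex_unit ` vertices G \<or> ?z \<in> vertex_unit ` vertices G"
    using x by (simp add: irreducibles_def local_units_nf del: free_act.simps nf_word.simps)
  then have "fs = []" by auto
  then show "x \<in> edge_nf G ` X" using s es by auto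
next
  fix x assume "x \<in> edge_nf G ` X"
  then obtain e where e: "x = edge_nf G e" "e \<in> X" by blast
  have "y \<in> vertex_unit ` vertices G \<or> z \<in> vertex_unit ` vertices G"
    if yz: "y \<in> paths_in X" "z \<in> paths_in X" and eq: "x = free_act G (nf_word y) z" for y z
  proof -
    obtain p es q fs where y: "y = Some (p, es)" "is_path G p es" "set es \<subseteq> X"
      and z: "z = Some (q, fs)" "is_path G q fs" "set fs \<subseteq> X"
      using yz by (auto simp: paths_in_def)
    have "x = (if path_end G p es = q then Some (p, es @ fs) else None)"
      using mult[OF y(2) z(2) y(3) z(3)] y(1) z(1) eq by simp
    then have "es @ fs = [e]" using e by (auto split: if_splits)
    then have "es = [] \<or> fs = []" by (auto simp: append_eq_Cons_conv)
    then show ?thesis using y z is_path_vertex by auto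
  qed
  moreover have "x \<in> paths_in X"
    using e X target_vertex by (auto simp: paths_in_def)
  moreover have "x \<notin> vertex_unit ` vertices G" using e by auto
  ultimately show "x \<in> irreducibles (nf_semigroup G) (paths_in X)"
    by (auto simp: irreducibles_def local_units_nf simp del: free_act.simps nf_word.simps)
qed

lemma irreducibles_right_cancellable:
  "irreducibles (nf_semigroup G) (right_cancellable (nf_semigroup G)) = edge_nf G ` neg_edges G"
  unfolding right_cancellable_nf
  by (rule irreducibles_paths_in[OF Un_upper1], rule nf_word_act_all_neg)
    (simp_all add: pos_before_neg_all_neg)

lemma irreducibles_left_cancellable:
  "irreducibles (nf_semigroup G) (left_cancellable (nf_semigroup G)) = edge_nf G ` pos_edges G"
  unfolding left_cancellable_nf
  by (rule irreducibles_paths_in[OF Un_upper2], rule nf_word_act_all_pos)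

lemma unit_mult_edge_iff:
  "free_act G (nf_word (vertex_unit p)) (edge_nf G e) = edge_nf G e \<longleftrightarrow> source G e = p"
  by simp

lemma edge_mult_unit_iff:
  "free_act G (nf_word (edge_nf G e)) (vertex_unit r) = edge_nf G e \<longleftrightarrow> target G e = r"
  by simp

lemma neg_mult_pos_unit_iff:
  assumes "f \<in> neg_edges G" "g \<in> pos_edges G"
  shows "free_act G (nf_word (edge_nf G f)) (edge_nf G g) \<in> local_units (nf_semigroup G)
    \<longleftrightarrow> (f, g) \<in> total_rel G"
  using assms total_relD[of f g] source_vertex[of f] by (auto simp: local_units_nf)

end

section \<open>Recovering the R-graph\<close>

text \<open>Turns the bijections between sets of semigroup elements into bijections between the vertices or
  edges that these elements come from.\<close>

lemma bij_betw_between_embeddings: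
  assumes "bij_betw h A B" "inj_on \<iota> X" "A = \<iota> ` X" "inj_on \<kappa> Y" "B = \<kappa> ` Y"
  obtains \<phi> where "bij_betw \<phi> X Y" "\<And>x. x \<in> X \<Longrightarrow> h (\<iota> x) = \<kappa> (\<phi> x)"
proof
  let ?\<phi> = "inv_into Y \<kappa> \<circ> (h \<circ> \<iota>)"
  have h: "bij_betw (h \<circ> \<iota>) X (\<kappa> ` Y)"
    using assms by (intro bij_betw_trans[of \<iota> X A]) (auto simp: bij_betw_def)
  then show "bij_betw ?\<phi> X Y"
    using bij_betw_inv_into[of \<kappa> Y "\<kappa> ` Y"] assms(4)
    by (auto intro: bij_betw_trans simp: inj_on_imp_bij_betw)
  show "h (\<iota> x) = \<kappa> (?\<phi> x)" if "x \<in> X" for x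
    using bij_betwE[OF h] that by (simp add: f_inv_into_f)
qed

theorem theorem2p1:
  fixes G :: "('v, 'e) r_graph" and H :: "('w, 'f) r_graph"
  assumes "is_r_graph G" and "is_r_graph H"
    and "semigroup0_isomorphic (r_graph_semigroup G) (r_graph_semigroup H)"
  shows "r_graph_isomorphic G H"
proof -
  interpret G: is_r_graph G by fact
  interpret H: is_r_graph H by fact
  have "semigroup0_isomorphic (nf_semigroup G) (nf_semigroup H)"
    using G.nf_semigroup_isomorphic assms(3)
      semigroup0_isomorphic_sym[OF H.nf_semigroup_isomorphic H.nf_semigroup_with_zero]
    by (blast intro: semigroup0_isomorphic_trans)
  then obtain h where h: "semigroup0_iso (nf_semigroup G) (nf_semigroup H) h"
    by (auto simp: semigroup0_isomorphic_iff_iso)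
  note S = G.nf_semigroup_with_zero
  note iso = S h
  have inj: "inj_on h (normal_forms G)"
    using iso_inj[OF iso] by simp
  have hom: "h (free_act G (nf_word x) y) = free_act H (nf_word (h x)) (h y)"
    if "x \<in> normal_forms G" "y \<in> normal_forms G" for x y
    using iso_mult[OF iso, of x y] that by simp

  have units: "vertex_unit ` vertices H = h ` vertex_unit ` vertices G"
    using iso_local_units[OF iso] by (simp add: G.local_units_nf H.local_units_nf)
  have negs: "edge_nf H ` neg_edges H = h ` edge_nf G ` neg_edges G"
    using iso_irreducibles[OF iso, of "right_cancellable (nf_semigroup G)"]
      iso_right_cancellable[OF iso] cancellable_carrier
    by (metis G.irreducibles_right_cancellable H.irreducibles_right_cancellable)
  have poss: "edge_nf H ` pos_edges H = h ` edge_nf G ` pos_edges G"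
    using iso_irreducibles[OF iso, of "left_cancellable (nf_semigroup G)"]
      iso_left_cancellable[OF iso] cancellable_carrier
    by (metis G.irreducibles_left_cancellable H.irreducibles_left_cancellable)

  have unit_nf: "vertex_unit p \<in> normal_forms G" if "p \<in> vertices G" for p
    using that by simp
  have edge_nf: "edge_nf G e \<in> normal_forms G" if "e \<in> neg_edges G \<or> e \<in> pos_edges G" for e
    using that G.target_vertex by auto

  have bij: "bij_betw h A B" if "A \<subseteq> normal_forms G" "B = h ` A" for A B
    using that inj by (auto simp: bij_betw_def intro: inj_on_subset)
  obtain \<phi> where \<phi>: "bij_betw \<phi> (vertices G) (vertices H)"
    and h_unit: "\<And>p. p \<in> vertices G \<Longrightarrow> h (vertex_unit p) = vertex_unit (\<phi> p)"
    by (rule bij_betw_between_embeddings[of h "vertex_unit ` vertices G" "vertex_unit ` vertices H"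
          vertex_unit "vertices G" vertex_unit "vertices H"])
      (auto intro!: bij units unit_nf inj_onI)
  obtain \<psi>\<^sub>m where \<psi>\<^sub>m: "bij_betw \<psi>\<^sub>m (neg_edges G) (neg_edges H)"
    and h_neg: "\<And>e. e \<in> neg_edges G \<Longrightarrow> h (edge_nf G e) = edge_nf H (\<psi>\<^sub>m e)"
    by (rule bij_betw_between_embeddings[of h "edge_nf G ` neg_edges G" "edge_nf H ` neg_edges H"
          "edge_nf G" "neg_edges G" "edge_nf H" "neg_edges H"])
      (auto intro!: bij negs edge_nf inj_onI)
  obtain \<psi>\<^sub>p where \<psi>\<^sub>p: "bij_betw \<psi>\<^sub>p (pos_edges G) (pos_edges H)"
    and h_pos: "\<And>e. e \<in> pos_edges G \<Longrightarrow> h (edge_nf G e) = edge_nf H (\<psi>\<^sub>p e)"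
    by (rule bij_betw_between_embeddings[of h "edge_nf G ` pos_edges G" "edge_nf H ` pos_edges H"
          "edge_nf G" "pos_edges G" "edge_nf H" "pos_edges H"])
      (auto intro!: bij poss edge_nf inj_onI)

  have ends: "source H e' = \<phi> (source G e) \<and> target H e' = \<phi> (target G e)"
    if e: "e \<in> neg_edges G \<or> e \<in> pos_edges G" and h_e: "h (edge_nf G e) = edge_nf H e'" for e e'
  proof
    note ends = G.source_vertex[OF e] G.target_vertex[OF e]
    have "free_act G (nf_word (vertex_unit (source G e))) (edge_nf G e) = edge_nf G e"
      by (simp only: G.unit_mult_edge_iff)
    then have "free_act H (nf_word (vertex_unit (\<phi> (source G e)))) (edge_nf H e') = edge_nf H e'"
      using hom[OF unit_nf[OF ends(1)] edge_nf[OF e]] h_unit[OF ends(1)] h_e by metis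
    then show "source H e' = \<phi> (source G e)"
      by (simp only: H.unit_mult_edge_iff)
    have "free_act G (nf_word (edge_nf G e)) (vertex_unit (target G e)) = edge_nf G e"
      by (simp only: G.edge_mult_unit_iff)
    then have "free_act H (nf_word (edge_nf H e')) (vertex_unit (\<phi> (target G e))) = edge_nf H e'"
      using hom[OF edge_nf[OF e] unit_nf[OF ends(2)]] h_unit[OF ends(2)] h_e by metis
    then show "target H e' = \<phi> (target G e)"
      by (simp only: H.edge_mult_unit_iff)
  qed

  have rel: "(\<psi>\<^sub>m f, \<psi>\<^sub>p g) \<in> total_rel H \<longleftrightarrow> (f, g) \<in> total_rel G"
    if f: "f \<in> neg_edges G" and g: "g \<in> pos_edges G" for f g
  proof -
    have nf: "edge_nf G f \<in> normal_forms G" "edge_nf G g \<in> normal_forms G"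
      using edge_nf f g by blast+
    have "\<psi>\<^sub>m f \<in> neg_edges H" "\<psi>\<^sub>p g \<in> pos_edges H"
      using bij_betwE[OF \<psi>\<^sub>m] bij_betwE[OF \<psi>\<^sub>p] f g by auto
    then have "(\<psi>\<^sub>m f, \<psi>\<^sub>p g) \<in> total_rel H \<longleftrightarrow>
        h (free_act G (nf_word (edge_nf G f)) (edge_nf G g)) \<in> local_units (nf_semigroup H)"
      using H.neg_mult_pos_unit_iff hom[OF nf] h_neg[OF f] h_pos[OF g] by simp
    also have "\<dots> \<longleftrightarrow> free_act G (nf_word (edge_nf G f)) (edge_nf G g) \<in> local_units (nf_semigroup G)"
      using iso_local_units_iff[OF iso] G.free_act_normal_form[OF nf(2) G.nf_word_free_carrier[OF nf(1)]]
      by simp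
    also have "\<dots> \<longleftrightarrow> (f, g) \<in> total_rel G"
      using G.neg_mult_pos_unit_iff[OF f g] .
    finally show ?thesis .
  qed
  have "map_prod \<psi>\<^sub>m \<psi>\<^sub>p ` total_rel G = total_rel H"
  proof (intro equalityI subsetI)
    fix z assume z: "z \<in> total_rel H"
    obtain f' g' where z': "z = (f', g')" by (cases z)
    then have "f' \<in> neg_edges H" "g' \<in> pos_edges H" using z H.total_relD by blast+
    then obtain f g where "f \<in> neg_edges G" "f' = \<psi>\<^sub>m f" "g \<in> pos_edges G" "g' = \<psi>\<^sub>p g"
      using bij_betw_imp_surj_on[OF \<psi>\<^sub>m] bij_betw_imp_surj_on[OF \<psi>\<^sub>p] by blast
    then show "z \<in> map_prod \<psi>\<^sub>m \<psi>\<^sub>p ` total_rel G"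
      using rel z z' by force
  qed (use rel G.total_relD in auto)
  then show ?thesis
    unfolding r_graph_isomorphic_def
    using \<phi> \<psi>\<^sub>m \<psi>\<^sub>p ends h_neg h_pos by (intro exI[of _ \<phi>] exI[of _ \<psi>\<^sub>m] exI[of _ \<psi>\<^sub>p]) blast
qed

end
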